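(* Let $h\in\mathfrak N=\{1/n:n\in\mathbb N,\ n\ge1\}$. For any integer $l\ge0$ and any $\phi\in H^l$ we have $$(\partial_x^jJ^h\phi,\partial_x^j\phi)\le0$$ for all integers $j\in\{0,\dots,l\}$.
   Context: $(\cdot,\cdot)$ is the inner product of $L_2(\mathbb R)$; $H^l$ is the Sobolev space of functions in $L_2(\mathbb R)$ with distributional derivatives up to order $l$ in $L_2(\mathbb R)$ ($H^0=L_2(\mathbb R)$). $\nu$ is a Lévy measure on $\mathbb R$: a Borel measure with $\nu(\{0\})=0$ and $\int_{\mathbb R}1\wedge z^2\,\nu(dz)<\infty$. For $\lambda\ne0$, $\delta_\lambda\phi(x)=\frac{\phi(x+\lambda)-\phi(x)}{\lambda}$. For $h\in\mathfrak N$: $B^h_k=((k-1)h,kh]$ for integers $k\ge1$, $B^h_k=[kh,(k+1)h)$ for integers $k\le-1$; $\mathbb A_h=\{k\in\mathbb Z:|k|\le1/h,\ k\ne0\}$, $\mathbb B_h=\mathbb Z\setminus(\mathbb A_h\cup\{0\})$; $s_k=k/|k|$, $\zeta^h_k=\int_{B^h_k}z^2\nu(dz)$, $\theta_k^l=\int_{l/|k|}^{(l+1)/|k|}(1-\theta)d\theta$; $$J_1^h\phi(x)=\sum_{k\in\mathbb A_h}\zeta_k^h\sum_{l=0}^{|k|-1}\theta_k^l\,\delta_{-h}\delta_h\phi(x+s_klh),\qquad J_2^h\phi(x)=\sum_{k\in\mathbb B_h}(\phi(x+hk)-\phi(x))\nu(B^h_k),$$ and $J^h=J_1^h+J_2^h$.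 *)

theory Defs
  imports "HOL-Analysis.Analysis"
begin

section \<open>Sobolev spaces on the real line\<close>

text \<open>Elements of $L_2$ and of $H^l$ are handled through representatives, so that equality of
  elements of these spaces is equality almost everywhere.\<close>

definition L2 :: "(real \<Rightarrow> real) set" where
  "L2 = {f. f \<in> borel_measurable lebesgue \<and> integrable lebesgue (\<lambda>x. (f x)\<^sup>2)}"

definition L2_inner :: "(real \<Rightarrow> real) \<Rightarrow> (real \<Rightarrow> real) \<Rightarrow> real" where
  "L2_inner f g = (\<integral>x. f x * g x \<partial>lebesgue)"

definition test_functions :: "(real \<Rightarrow> real) set" where
  "test_functions = {\<psi>. (\<forall>n x. (deriv ^^ n) \<psi> differentiable at x) \<and>
                        compact (closure {x. \<psi> x \<noteq> 0})}"

definition has_L2_weak_deriv :: "nat \<Rightarrow> (real \<Rightarrow> real) \<Rightarrow> (real \<Rightarrow> real) \<Rightarrow> bool" where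
  "has_L2_weak_deriv j f g \<longleftrightarrow> f \<in> L2 \<and> g \<in> L2 \<and>
     (\<forall>\<psi>\<in>test_functions.
        (\<integral>x. f x * (deriv ^^ j) \<psi> x \<partial>lebesgue) = (- 1) ^ j * (\<integral>x. g x * \<psi> x \<partial>lebesgue))"

definition sobolev :: "nat \<Rightarrow> (real \<Rightarrow> real) set" where
  "sobolev l = {f \<in> L2. \<forall>j\<le>l. \<exists>g. has_L2_weak_deriv j f g}"

text \<open>The weak derivative is unique up to null sets; the operator below picks a representative,
  and is meaningful only for functions possessing a weak derivative of order \<open>j\<close> in $L_2$.\<close>

definition weak_deriv :: "nat \<Rightarrow> (real \<Rightarrow> real) \<Rightarrow> real \<Rightarrow> real" where
  "weak_deriv j f = (SOME g. has_L2_weak_deriv j f g)"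


section \<open>Levy measures and the discretised operator\<close>

definition levy_measure :: "real measure \<Rightarrow> bool" where
  "levy_measure \<nu> \<longleftrightarrow> sets \<nu> = sets borel \<and> emeasure \<nu> {0} = 0 \<and>
     (\<integral>\<^sup>+z. ennreal (min 1 (z\<^sup>2)) \<partial>\<nu>) < \<infinity>"

definition mesh_sizes :: "real set" where
  "mesh_sizes = {1 / real n | n. n \<ge> 1}"

definition diff_quot :: "real \<Rightarrow> (real \<Rightarrow> real) \<Rightarrow> real \<Rightarrow> real" where
  "diff_quot d \<phi> x = (\<phi> (x + d) - \<phi> x) / d"

text \<open>The index \<open>k = 0\<close> is never used.\<close>

definition cell :: "real \<Rightarrow> int \<Rightarrow> real set" where
  "cell h k = (if k \<ge> 1 then {(of_int k - 1) * h <.. of_int k * h}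
               else {of_int k * h ..< (of_int k + 1) * h})"

definition near_idx :: "real \<Rightarrow> int set" where
  "near_idx h = {k. \<bar>of_int k\<bar> \<le> 1 / h \<and> k \<noteq> 0}"

definition far_idx :: "real \<Rightarrow> int set" where
  "far_idx h = UNIV - (near_idx h \<union> {0})"

definition zeta :: "real measure \<Rightarrow> real \<Rightarrow> int \<Rightarrow> real" where
  "zeta \<nu> h k = (\<integral>z\<in>cell h k. z\<^sup>2 \<partial>\<nu>)"

definition theta :: "int \<Rightarrow> nat \<Rightarrow> real" where
  "theta k l = (\<integral>t\<in>{real l / of_int \<bar>k\<bar> .. (real l + 1) / of_int \<bar>k\<bar>}. (1 - t) \<partial>lborel)"

definition J1 :: "real measure \<Rightarrow> real \<Rightarrow> (real \<Rightarrow> real) \<Rightarrow> real \<Rightarrow> real" where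
  "J1 \<nu> h \<phi> x = (\<Sum>k\<in>near_idx h. zeta \<nu> h k *
     (\<Sum>l<nat \<bar>k\<bar>. theta k l * diff_quot (- h) (diff_quot h \<phi>) (x + of_int (sgn k) * real l * h)))"

text \<open>Since \<open>\<nu>\<close> gives finite mass to the union of the cells involved, for \<open>\<phi>\<close> in $L_2$ the series
  below converges absolutely for almost every \<open>x\<close>, with a sum in $L_2$; the value on the
  exceptional null set is irrelevant.\<close>

definition J2 :: "real measure \<Rightarrow> real \<Rightarrow> (real \<Rightarrow> real) \<Rightarrow> real \<Rightarrow> real" where
  "J2 \<nu> h \<phi> x = (\<Sum>\<^sub>\<infinity>k\<in>far_idx h. (\<phi> (x + h * of_int k) - \<phi> x) * measure \<nu> (cell h k))"

definition J :: "real measure \<Rightarrow> real \<Rightarrow> (real \<Rightarrow> real) \<Rightarrow> real \<Rightarrow> real" where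
  "J \<nu> h \<phi> x = J1 \<nu> h \<phi> x + J2 \<nu> h \<phi> x"

end

theory Submission
  imports Defs "HOL-Computational_Algebra.Polynomial"
begin

text \<open>The operator \<open>J\<close> is an absolutely convergent combination of translations, so it is bounded on
  \<open>L2\<close> and commutes with weak derivatives, which are unique up to null sets; it therefore suffices
  to show \<open>(J f, f) \<le> 0\<close> for \<open>f\<close> in \<open>L2\<close>. The autocorrelation \<open>c d = (f (\<cdot> + d), f)\<close> is even
  and satisfies \<open>c d \<le> c 0\<close>. Each far term contributes a nonnegative multiple of \<open>c (h k) - c 0\<close>.
  In a near term the weights \<open>theta k l\<close> are affine in \<open>l\<close>, so summing by parts twice
  turns the second differences of \<open>c\<close> into a nonnegative combination of differences \<open>c (m h) - c 0\<close>.\<close>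

section \<open>Square-integrable functions\<close>

lemma L2_measurable: "f \<in> L2 \<Longrightarrow> f \<in> borel_measurable lebesgue"
  and L2_square_integrable: "f \<in> L2 \<Longrightarrow> integrable lebesgue (\<lambda>x. (f x)\<^sup>2)"
  by (auto simp: L2_def)

lemma abs_mult_le_sum_squares: "\<bar>a * b\<bar> \<le> a\<^sup>2 + b\<^sup>2" for a b :: real
proof -
  have "2 * \<bar>a * b\<bar> \<le> a\<^sup>2 + b\<^sup>2"
    using sum_squares_bound[of "\<bar>a\<bar>" "\<bar>b\<bar>"] by (simp add: abs_mult mult.assoc)
  then show ?thesis
    using abs_ge_zero[of "a * b"] by linarith
qed

lemma L2_mult_integrable:
  assumes "f \<in> L2" "g \<in> L2"
  shows "integrable lebesgue (\<lambda>x. f x * g x)"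
proof (rule Bochner_Integration.integrable_bound)
  show "integrable lebesgue (\<lambda>x. (f x)\<^sup>2 + (g x)\<^sup>2)"
    using assms by (simp add: L2_square_integrable)
  show "(\<lambda>x. f x * g x) \<in> borel_measurable lebesgue"
    using assms by (intro borel_measurable_times L2_measurable)
  show "AE x in lebesgue. norm (f x * g x) \<le> norm ((f x)\<^sup>2 + (g x)\<^sup>2)"
    by (simp add: abs_mult_le_sum_squares)
qed

lemma L2_zero: "(\<lambda>x. 0) \<in> L2"
  by (simp add: L2_def)

lemma L2_add:
  assumes "f \<in> L2" "g \<in> L2"
  shows "(\<lambda>x. f x + g x) \<in> L2"
proof -
  have "integrable lebesgue (\<lambda>x. (f x)\<^sup>2 + (g x)\<^sup>2 + 2 * (f x * g x))"
    using assms by (simp add: L2_mult_integrable L2_square_integrable)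
  also have "(\<lambda>x. (f x)\<^sup>2 + (g x)\<^sup>2 + 2 * (f x * g x)) = (\<lambda>x. (f x + g x)\<^sup>2)"
    by (simp add: power2_sum mult.assoc)
  finally show ?thesis
    using assms by (auto simp: L2_def intro: borel_measurable_add)
qed

lemma L2_cmult: "f \<in> L2 \<Longrightarrow> (\<lambda>x. c * f x) \<in> L2"
  by (auto simp: L2_def power_mult_distrib intro!: borel_measurable_times)

lemma L2_diff: "f \<in> L2 \<Longrightarrow> g \<in> L2 \<Longrightarrow> (\<lambda>x. f x - g x) \<in> L2"
  using L2_add[of f "\<lambda>x. - 1 * g x"] L2_cmult[of g "-1"] by simp

lemma L2_translate:
  assumes "f \<in> L2"
  shows "(\<lambda>x. f (x + a)) \<in> L2"
proof -
  have "(\<lambda>x. f (a + 1 * x)) \<in> borel_measurable lebesgue"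
    using assms borel_measurable_affine[of f 1] by (simp add: L2_measurable)
  moreover have "integrable lebesgue (\<lambda>x. (f (a + 1 * x))\<^sup>2)"
    using lebesgue_integrable_real_affine[of "\<lambda>x. (f x)\<^sup>2" 1 a] assms
    by (simp add: L2_square_integrable)
  ultimately show ?thesis
    by (simp add: L2_def add.commute)
qed

lemma lebesgue_integral_translate:
  fixes f :: "real \<Rightarrow> real"
  shows "(\<integral>x. f (x + a) \<partial>lebesgue) = (\<integral>x. f x \<partial>lebesgue)"
  using lebesgue_integral_real_affine[of 1 f a] by (simp add: add.commute)

lemma L2_inner_commute: "L2_inner f g = L2_inner g f"
  by (simp add: L2_inner_def mult.commute)

lemma L2_inner_add_left:
  "f \<in> L2 \<Longrightarrow> g \<in> L2 \<Longrightarrow> u \<in> L2 \<Longrightarrow> L2_inner (\<lambda>x. f x + g x) u = L2_inner f u + L2_inner g u"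
  by (simp add: L2_inner_def distrib_right L2_mult_integrable)

lemma L2_inner_diff_left:
  "f \<in> L2 \<Longrightarrow> g \<in> L2 \<Longrightarrow> u \<in> L2 \<Longrightarrow> L2_inner (\<lambda>x. f x - g x) u = L2_inner f u - L2_inner g u"
  by (simp add: L2_inner_def left_diff_distrib L2_mult_integrable)

lemma L2_inner_add_right:
  "f \<in> L2 \<Longrightarrow> g \<in> L2 \<Longrightarrow> u \<in> L2 \<Longrightarrow> L2_inner u (\<lambda>x. f x + g x) = L2_inner u f + L2_inner u g"
  by (simp add: L2_inner_def distrib_left L2_mult_integrable)

lemma L2_inner_diff_right:
  "f \<in> L2 \<Longrightarrow> g \<in> L2 \<Longrightarrow> u \<in> L2 \<Longrightarrow> L2_inner u (\<lambda>x. f x - g x) = L2_inner u f - L2_inner u g"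
  by (simp add: L2_inner_def right_diff_distrib L2_mult_integrable)

lemma L2_inner_cmult_left: "L2_inner (\<lambda>x. c * f x) u = c * L2_inner f u"
  by (simp add: L2_inner_def mult.assoc)

lemma L2_sum:
  assumes "\<And>i. i \<in> I \<Longrightarrow> f i \<in> L2"
  shows "(\<lambda>x. \<Sum>i\<in>I. f i x) \<in> L2"
  using assms by (induction I rule: infinite_finite_induct) (auto simp: L2_zero L2_add)

lemma L2_inner_sum_left:
  assumes "\<And>i. i \<in> I \<Longrightarrow> f i \<in> L2" "u \<in> L2"
  shows "L2_inner (\<lambda>x. \<Sum>i\<in>I. f i x) u = (\<Sum>i\<in>I. L2_inner (f i) u)"
  using assms by (simp add: L2_inner_def sum_distrib_right L2_mult_integrable)

section \<open>Translations and autocorrelation\<close>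

lemma L2_inner_translate:
  "L2_inner (\<lambda>x. f (x + a)) (\<lambda>x. g (x + a)) = L2_inner f g"
  unfolding L2_inner_def using lebesgue_integral_translate[of "\<lambda>x. f x * g x" a] by simp

lemma L2_inner_translate_left:
  "L2_inner (\<lambda>x. f (x + a)) g = L2_inner f (\<lambda>x. g (x - a))"
  using L2_inner_translate[of f a "\<lambda>x. g (x - a)"] by simp

text \<open>The adjoint of a translation is the opposite translation, and the real inner product is
  symmetric. The argument is written \<open>x + (- a)\<close> so that the translation lemmas match
  it.\<close>

lemma L2_autocorrelation_even:
  "L2_inner (\<lambda>x. f (x + (- a))) f = L2_inner (\<lambda>x. f (x + a)) f"
  by (subst L2_inner_translate_left) (simp add: L2_inner_commute)

text \<open>Expand the nonnegative squared norm of \<open>f (x + a) - f x\<close>; both squares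
  contribute \<open>L2_inner f f\<close>, because translation preserves the norm.\<close>

lemma L2_autocorrelation_le:
  assumes "f \<in> L2"
  shows "L2_inner (\<lambda>x. f (x + a)) f \<le> L2_inner f f"
proof -
  let ?g = "\<lambda>x. f (x + a)"
  have g: "?g \<in> L2"
    using assms by (rule L2_translate)
  have "0 \<le> L2_inner (\<lambda>x. ?g x - f x) (\<lambda>x. ?g x - f x)"
    by (simp add: L2_inner_def)
  also have "\<dots> = L2_inner ?g ?g - 2 * L2_inner ?g f + L2_inner f f"
    using assms g L2_inner_commute[of f ?g]
    by (simp add: L2_diff L2_inner_diff_left L2_inner_diff_right)
  also have "L2_inner ?g ?g = L2_inner f f"
    by (rule L2_inner_translate)
  finally show ?thesis
    by simp
qed

text \<open>The parallelogram identity for \<open>f\<close> and its translate. What matters is that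
  the bound is uniform in \<open>a\<close>, so that it serves for all terms of the far series at
  once.\<close>

lemma L2_translate_diff_le:
  assumes "f \<in> L2"
  shows "L2_inner (\<lambda>x. f (x + a) - f x) (\<lambda>x. f (x + a) - f x) \<le> 4 * L2_inner f f"
proof -
  let ?g = "\<lambda>x. f (x + a)"
  have g: "?g \<in> L2"
    using assms by (rule L2_translate)
  have "0 \<le> L2_inner (\<lambda>x. ?g x + f x) (\<lambda>x. ?g x + f x)"
    by (simp add: L2_inner_def)
  moreover have "L2_inner (\<lambda>x. ?g x + f x) (\<lambda>x. ?g x + f x) + L2_inner (\<lambda>x. ?g x - f x) (\<lambda>x. ?g x - f x)
      = 2 * L2_inner ?g ?g + 2 * L2_inner f f"
    using assms g
    by (simp add: L2_add L2_inner_add_left L2_inner_add_right L2_diff L2_inner_diff_left L2_inner_diff_right)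
  moreover have "L2_inner ?g ?g = L2_inner f f"
    by (rule L2_inner_translate)
  ultimately show ?thesis
    by simp
qed


section \<open>Test functions and weak derivatives\<close>

lemma deriv_translate: "deriv (\<lambda>x. f (x + a)) x = deriv f (x + a)" for f :: "real \<Rightarrow> real"
  by (simp add: deriv_def DERIV_shift)

lemma higher_deriv_translate:
  fixes f :: "real \<Rightarrow> real"
  shows "(deriv ^^ n) (\<lambda>x. f (x + a)) = (\<lambda>x. (deriv ^^ n) f (x + a))"
  by (induction n) (auto simp: deriv_translate)

lemma test_functions_translate:
  assumes "\<psi> \<in> test_functions"
  shows "(\<lambda>x. \<psi> (x + a)) \<in> test_functions"
proof -
  have "(deriv ^^ n) (\<lambda>x. \<psi> (x + a)) differentiable at x" for n x
  proof -
    have "(deriv ^^ n) \<psi> differentiable at (x + a)"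
      using assms by (auto simp: test_functions_def)
    then obtain D where "((deriv ^^ n) \<psi> has_field_derivative D) (at (x + a))"
      by (auto simp: real_differentiable_def)
    then have "((\<lambda>x. (deriv ^^ n) \<psi> (x + a)) has_field_derivative D) (at x)"
      by (simp add: DERIV_shift)
    then show ?thesis
      unfolding higher_deriv_translate by (auto simp: real_differentiable_def)
  qed
  moreover have "compact (closure {x. \<psi> (x + a) \<noteq> 0})"
  proof -
    have "{x. \<psi> (x + a) \<noteq> 0} = (\<lambda>x. - a + x) ` {x. \<psi> x \<noteq> 0}"
      by (auto simp: image_iff intro!: exI[of _ "_ + a"])
    then have "closure {x. \<psi> (x + a) \<noteq> 0} = (\<lambda>x. - a + x) ` closure {x. \<psi> x \<noteq> 0}"
      by (metis closure_translation)
    then show ?thesis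
      using assms by (metis (no_types, lifting) compact_translation mem_Collect_eq test_functions_def)
  qed
  ultimately show ?thesis
    by (simp add: test_functions_def)
qed

text \<open>Openness carries the induction: the lower derivative vanishes on a whole neighbourhood
  of the point, so it may be exchanged for the zero function before differentiating.\<close>

lemma higher_deriv_eq_0:
  fixes f :: "real \<Rightarrow> real"
  assumes "open U" "\<And>x. x \<in> U \<Longrightarrow> f x = 0" "x \<in> U"
  shows "(deriv ^^ n) f x = 0"
  using assms(3)
proof (induction n arbitrary: x)
  case 0
  then show ?case using assms(2) by simp
next
  case (Suc n)
  have "((deriv ^^ n) f has_field_derivative 0) (at x)"
    by (rule has_field_derivative_transform_within_open[where f = "\<lambda>_. 0" and S = U])
       (use Suc assms(1) in auto)
  then show ?case
    by (simp add: DERIV_imp_deriv)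
qed

lemma test_functions_higher_deriv_L2:
  assumes "\<psi> \<in> test_functions"
  shows "(deriv ^^ n) \<psi> \<in> L2"
proof -
  let ?g = "(deriv ^^ n) \<psi>" and ?S = "closure {x. \<psi> x \<noteq> 0}"
  have cont: "continuous_on UNIV ?g"
    using assms by (auto simp: test_functions_def intro!: continuous_at_imp_continuous_on
        differentiable_imp_continuous_within)
  \<comment> \<open>Differentiation does not enlarge the support, so the continuous function
    \<open>?g\<close> lives on the compact set \<open>?S\<close>, and its square is
    integrable.\<close>
  have "?g x = 0" if "x \<notin> ?S" for x
    by (rule higher_deriv_eq_0[where U = "- ?S"])
       (use that closure_subset[of "{x. \<psi> x \<noteq> 0}"] in auto)
  then have "(\<lambda>x. indicator ?S x *\<^sub>R (?g x)\<^sup>2) = (\<lambda>x. (?g x)\<^sup>2)"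
    by (auto simp: fun_eq_iff indicator_def)
  moreover have "integrable lborel (\<lambda>x. indicator ?S x *\<^sub>R (?g x)\<^sup>2)"
    using assms cont by (intro borel_integrable_compact continuous_intros)
      (auto simp: test_functions_def intro: continuous_on_subset)
  moreover have m: "?g \<in> borel_measurable lborel"
    using cont by (simp add: borel_measurable_continuous_onI)
  ultimately show ?thesis
    by (simp add: L2_def measurable_completion integrable_completion)
qed

lemma test_functions_L2: "\<psi> \<in> test_functions \<Longrightarrow> \<psi> \<in> L2"
  using test_functions_higher_deriv_L2[of \<psi> 0] by simp

text \<open>Brings the definition into the language of \<open>L2_inner\<close>, where the linearity,
  translation and series lemmas apply directly.\<close>

lemma has_L2_weak_deriv_iff:
  "has_L2_weak_deriv j f g \<longleftrightarrow> f \<in> L2 \<and> g \<in> L2 \<and>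
     (\<forall>\<psi>\<in>test_functions. L2_inner f ((deriv ^^ j) \<psi>) = (- 1) ^ j * L2_inner g \<psi>)"
  by (simp add: has_L2_weak_deriv_def L2_inner_def)

lemma has_L2_weak_deriv_L2:
  assumes "has_L2_weak_deriv j f g"
  shows "f \<in> L2" "g \<in> L2"
  using assms by (simp_all add: has_L2_weak_deriv_def)

lemma has_L2_weak_deriv_0: "f \<in> L2 \<Longrightarrow> has_L2_weak_deriv 0 f f"
  by (simp add: has_L2_weak_deriv_def)

lemma has_L2_weak_deriv_add:
  assumes "has_L2_weak_deriv j f f'" "has_L2_weak_deriv j g g'"
  shows "has_L2_weak_deriv j (\<lambda>x. f x + g x) (\<lambda>x. f' x + g' x)"
  using assms by (simp add: has_L2_weak_deriv_iff L2_add L2_inner_add_left distrib_left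
      test_functions_higher_deriv_L2 test_functions_L2)

lemma has_L2_weak_deriv_cmult:
  assumes "has_L2_weak_deriv j f f'"
  shows "has_L2_weak_deriv j (\<lambda>x. c * f x) (\<lambda>x. c * f' x)"
  using assms by (simp add: has_L2_weak_deriv_iff L2_cmult L2_inner_cmult_left)

lemma has_L2_weak_deriv_diff:
  assumes "has_L2_weak_deriv j f f'" "has_L2_weak_deriv j g g'"
  shows "has_L2_weak_deriv j (\<lambda>x. f x - g x) (\<lambda>x. f' x - g' x)"
  using has_L2_weak_deriv_add[OF assms(1) has_L2_weak_deriv_cmult[OF assms(2), of "-1"]] by simp

lemma has_L2_weak_deriv_sum:
  assumes "\<And>i. i \<in> I \<Longrightarrow> has_L2_weak_deriv j (f i) (g i)"
  shows "has_L2_weak_deriv j (\<lambda>x. \<Sum>i\<in>I. f i x) (\<lambda>x. \<Sum>i\<in>I. g i x)"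
proof -
  have "has_L2_weak_deriv j (\<lambda>x. 0) (\<lambda>x. 0)"
    by (simp add: has_L2_weak_deriv_iff L2_zero L2_inner_def)
  with assms show ?thesis
    by (induction I rule: infinite_finite_induct) (auto intro: has_L2_weak_deriv_add)
qed

text \<open>The shift is moved onto the test function, which stays a test function, and there it
  commutes with differentiation.\<close>

lemma has_L2_weak_deriv_translate:
  assumes "has_L2_weak_deriv j f g"
  shows "has_L2_weak_deriv j (\<lambda>x. f (x + a)) (\<lambda>x. g (x + a))"
proof -
  have "L2_inner (\<lambda>x. f (x + a)) ((deriv ^^ j) \<psi>) = (- 1) ^ j * L2_inner (\<lambda>x. g (x + a)) \<psi>"
    if "\<psi> \<in> test_functions" for \<psi>
  proof -
    have "(\<lambda>x. \<psi> (x + - a)) \<in> test_functions"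
      using that by (rule test_functions_translate)
    with assms have "L2_inner f ((deriv ^^ j) (\<lambda>x. \<psi> (x + - a))) = (- 1) ^ j * L2_inner g (\<lambda>x. \<psi> (x + - a))"
      unfolding has_L2_weak_deriv_iff by blast
    then show ?thesis
      by (simp add: higher_deriv_translate[of j \<psi> "- a", simplified] L2_inner_translate_left)
  qed
  then show ?thesis
    using assms by (simp add: has_L2_weak_deriv_iff L2_translate)
qed


section \<open>Smooth bumps and uniqueness of weak derivatives\<close>

text \<open>For \<open>m = 0\<close> this is the classical smooth function that is flat at 0. The
  exponent \<open>m\<close> makes the family closed under differentiation, up to linear
  combinations, and the parameter \<open>c\<close> is later sent to 0.\<close>

definition flat_exp :: "real \<Rightarrow> nat \<Rightarrow> real \<Rightarrow> real" where
  "flat_exp c m t = (if t > 0 then exp (- c / t) / t ^ m else 0)"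

lemma flat_exp_Suc: "t * flat_exp c (Suc m) t = flat_exp c m t"
  by (simp add: flat_exp_def)

text \<open>With \<open>s = c / t\<close> the function is a constant times
  \<open>s ^ m / exp s\<close>, and \<open>s\<close> tends to infinity as \<open>t\<close> decreases
  to 0.\<close>

lemma flat_exp_tendsto_0:
  assumes "c > 0"
  shows "(flat_exp c m \<longlongrightarrow> 0) (at_right 0)"
proof -
  have "((\<lambda>t. inverse (c ^ m) * ((c / t) ^ m / exp (c / t))) \<longlongrightarrow> inverse (c ^ m) * 0) (at_right 0)"
  proof (intro tendsto_mult tendsto_const filterlim_compose[OF tendsto_power_div_exp_0])
    show "filterlim (\<lambda>t. c / t) at_top (at_right 0)"
      using filterlim_tendsto_pos_mult_at_top[OF tendsto_const assms filterlim_inverse_at_top_right]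
      by (simp add: divide_inverse)
  qed
  moreover have "\<forall>\<^sub>F t in at_right 0. inverse (c ^ m) * ((c / t) ^ m / exp (c / t)) = flat_exp c m t"
    using eventually_at_right_less[of 0]
    by eventually_elim (use assms in \<open>simp add: flat_exp_def exp_minus field_simps power_divide\<close>)
  ultimately show ?thesis
    by (simp add: filterlim_cong)
qed

lemma DERIV_flat_exp:
  assumes "c > 0"
  shows "(flat_exp c m has_real_derivative c * flat_exp c (m + 2) t - real m * flat_exp c (m + 1) t) (at t)"
proof -
  consider "t > 0" | "t < 0" | "t = 0" by linarith
  then show ?thesis
  proof cases
    case 1
    have "((\<lambda>t. exp (- c / t) / t ^ m) has_real_derivative
        (exp (- c / t) * (c / t\<^sup>2) * t ^ m - exp (- c / t) * (real m * t ^ (m - Suc 0))) / (t ^ m * t ^ m)) (at t)"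
      using 1 by (auto intro!: derivative_eq_intros simp: power2_eq_square)
    also have "(exp (- c / t) * (c / t\<^sup>2) * t ^ m - exp (- c / t) * (real m * t ^ (m - Suc 0))) / (t ^ m * t ^ m)
        = c * flat_exp c (m + 2) t - real m * flat_exp c (m + 1) t"
      using 1 by (cases m) (simp_all add: flat_exp_def field_simps power2_eq_square)
    finally show ?thesis
      by (rule has_field_derivative_transform_within_open[where S = "{0<..}"])
         (use 1 in \<open>auto simp: flat_exp_def\<close>)
  next
    case 2
    have "((\<lambda>t. 0) has_real_derivative 0) (at t)"
      by simp
    then have "(flat_exp c m has_real_derivative 0) (at t)"
      by (rule has_field_derivative_transform_within_open[where S = "{..<0}"])
         (use 2 in \<open>auto simp: flat_exp_def\<close>)
    then show ?thesis
      using 2 by (simp add: flat_exp_def)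
  next
    case 3
    have "((\<lambda>y. flat_exp c (Suc m) y) \<longlongrightarrow> 0) (at 0)"
    proof (rule filterlim_split_at)
      show "((\<lambda>y. flat_exp c (Suc m) y) \<longlongrightarrow> 0) (at_left 0)"
        by (rule tendsto_eventually) (simp add: eventually_at_filter flat_exp_def)
    qed (rule flat_exp_tendsto_0[OF assms])
    \<comment> \<open>At the gluing point the difference quotient is itself a member of the family,
      with exponent raised by one, so its limit is already known.\<close>
    moreover have "\<forall>\<^sub>F y in at 0. flat_exp c (Suc m) y = (flat_exp c m y - flat_exp c m 0) / (y - 0)"
      using eventually_neq_at_within[of 0]
      by eventually_elim (simp add: flat_exp_def)
    ultimately have "((\<lambda>y. (flat_exp c m y - flat_exp c m 0) / (y - 0)) \<longlongrightarrow> 0) (at 0)"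
      by (rule Lim_transform_eventually)
    then show ?thesis
      using 3 by (simp add: has_field_derivative_iff flat_exp_def)
  qed
qed

text \<open>All terms of the product and chain rules are raised to the common exponent
  \<open>m + 2\<close> at the cost of factors \<open>q\<close>. The derivative then has the original
  shape, polynomial times \<open>flat_exp\<close> of \<open>q\<close>, so that differentiation can
  be iterated.\<close>

lemma DERIV_poly_flat_exp:
  assumes "c > 0"
  shows "((\<lambda>x. poly p x * flat_exp c m (poly q x)) has_real_derivative
    poly (pderiv p * q\<^sup>2 + p * pderiv q * ([:c:] - smult (real m) q)) x
      * flat_exp c (Suc (Suc m)) (poly q x)) (at x)"
proof -
  have "((\<lambda>x. poly p x * flat_exp c m (poly q x)) has_real_derivative
     poly p x * ((c * flat_exp c (m + 2) (poly q x) - real m * flat_exp c (m + 1) (poly q x)) * poly (pderiv q) x)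
     + poly (pderiv p) x * flat_exp c m (poly q x)) (at x)"
    by (rule DERIV_mult' poly_DERIV DERIV_chain2[OF DERIV_flat_exp] assms)+
  moreover have "flat_exp c (m + 1) (poly q x) = poly q x * flat_exp c (Suc (Suc m)) (poly q x)"
    by (simp add: flat_exp_Suc)
  moreover have "flat_exp c m (poly q x) = (poly q x)\<^sup>2 * flat_exp c (Suc (Suc m)) (poly q x)"
    by (simp add: power2_eq_square mult.assoc flat_exp_Suc)
  ultimately show ?thesis
    by (simp add: algebra_simps)
qed

lemma higher_deriv_poly_flat_exp:
  assumes "c > 0"
  shows "\<exists>p' m'. (deriv ^^ n) (\<lambda>x. poly p x * flat_exp c m (poly q x))
    = (\<lambda>x. poly p' x * flat_exp c m' (poly q x))"
proof (induction n)
  case (Suc n)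
  then obtain p' m' where "(deriv ^^ n) (\<lambda>x. poly p x * flat_exp c m (poly q x))
    = (\<lambda>x. poly p' x * flat_exp c m' (poly q x))"
    by blast
  then have "(deriv ^^ Suc n) (\<lambda>x. poly p x * flat_exp c m (poly q x))
      = deriv (\<lambda>x. poly p' x * flat_exp c m' (poly q x))"
    by simp
  also have "\<dots> = (\<lambda>x. poly (pderiv p' * q\<^sup>2 + p' * pderiv q * ([:c:] - smult (real m') q)) x
      * flat_exp c (Suc (Suc m')) (poly q x))"
    by (rule ext, rule DERIV_imp_deriv, rule DERIV_poly_flat_exp[OF assms])
  finally show ?case
    by blast
qed auto

lemma flat_exp_bump_test_function:
  assumes "c > 0"
  shows "(\<lambda>x. flat_exp c 0 ((x - a) * (b - x))) \<in> test_functions"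
proof -
  define q where "q = [:- a, 1:] * [:b, - 1:]"
  have q: "poly q x = (x - a) * (b - x)" for x
    by (simp add: q_def algebra_simps)
  \<comment> \<open>The factor \<open>poly 1 x\<close> presents the bump as a member of the family
    that is closed under \<open>deriv\<close>.\<close>
  have "(deriv ^^ n) (\<lambda>x. poly 1 x * flat_exp c 0 (poly q x)) differentiable at x" for n x
  proof -
    obtain p m where eq: "(deriv ^^ n) (\<lambda>x. poly 1 x * flat_exp c 0 (poly q x))
        = (\<lambda>x. poly p x * flat_exp c m (poly q x))"
      using higher_deriv_poly_flat_exp[OF assms] by blast
    show ?thesis
      unfolding eq real_differentiable_def using DERIV_poly_flat_exp[OF assms] by blast
  qed
  moreover have "compact (closure {x. flat_exp c 0 ((x - a) * (b - x)) \<noteq> 0})"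
  proof -
    \<comment> \<open>No order between \<open>a\<close> and \<open>b\<close> is assumed; the product
      is positive exactly strictly between them.\<close>
    have "{x. flat_exp c 0 ((x - a) * (b - x)) \<noteq> 0} \<subseteq> {min a b..max a b}"
      by (auto simp: flat_exp_def zero_less_mult_iff split: if_splits)
    then have "bounded {x. flat_exp c 0 ((x - a) * (b - x)) \<noteq> 0}"
      by (rule bounded_subset[rotated]) simp
    then show ?thesis
      by (simp add: compact_closure)
  qed
  ultimately show ?thesis
    by (simp add: test_functions_def q)
qed

section \<open>From orthogonality to test functions to vanishing almost everywhere\<close>

lemma borel_measurable_lebesgue_indicator_Icc:
  fixes u :: "real \<Rightarrow> real"
  assumes "u \<in> borel_measurable lebesgue"
  shows "(\<lambda>x. indicator {a..b} x *\<^sub>R u x) \<in> borel_measurable lebesgue"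
  using assms by (intro borel_measurable_scaleR borel_measurable_indicator) auto

text \<open>The indicator of a bounded measurable set is itself in \<open>L2\<close>, so this is
  integrability of a product of two elements of \<open>L2\<close>.\<close>

lemma set_integrable_L2:
  assumes "u \<in> L2" "bounded A" "A \<in> sets lebesgue"
  shows "set_integrable lebesgue A u"
proof -
  have "(\<lambda>x. indicator A x) \<in> L2"
    using lmeasurable_iff_integrable[of A] bounded_set_imp_lmeasurable[OF assms(2,3)] assms(3)
    by (simp add: L2_def power2_eq_square flip: indicator_inter_arith)
  from L2_mult_integrable[OF this assms(1)] show ?thesis
    by (simp add: set_integrable_def)
qed

text \<open>The bumps \<open>exp (- 1 / (n (x - a) (b - x)))\<close> are test functions that converge boundedly
  to the indicator of \<open>{a<..<b}\<close>, so no mollification is needed.\<close>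

lemma set_integral_eq_0_if_orthogonal_test_functions:
  assumes u: "u \<in> L2" and orth: "\<And>\<psi>. \<psi> \<in> test_functions \<Longrightarrow> L2_inner u \<psi> = 0"
  shows "(LINT x:{a..b}|lebesgue. u x) = 0"
proof -
  \<comment> \<open>For \<open>b < a\<close> the bump would live on the reversed interval, whereas
    \<open>{a..b}\<close> is empty; hence the zero function when \<open>a < b\<close> fails.\<close>
  define \<psi> where "\<psi> = (\<lambda>n x. if a < b then flat_exp (inverse (real (Suc n))) 0 ((x - a) * (b - x)) else 0)"
  note [measurable] = L2_measurable[OF u]
  have zero: "(\<lambda>x. 0) \<in> test_functions"
  proof -
    have "(deriv ^^ n) (\<lambda>x. 0::real) = (\<lambda>x. 0)" for n
      by (induction n) auto
    then show ?thesis by (simp add: test_functions_def)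
  qed
  then have test: "\<psi> n \<in> test_functions" for n
    using flat_exp_bump_test_function[of "inverse (real (Suc n))" a b]
    by (cases "a < b") (auto simp: \<psi>_def)
  have "(\<lambda>n. \<integral>x. u x * \<psi> n x \<partial>lebesgue) \<longlonglongrightarrow> (\<integral>x. indicator {a..b} x *\<^sub>R u x \<partial>lebesgue)"
  proof (rule integral_dominated_convergence[where w = "\<lambda>x. norm (indicator {a..b} x *\<^sub>R u x)"])
    show "(\<lambda>x. u x * \<psi> n x) \<in> borel_measurable lebesgue" for n
      using L2_measurable[OF test_functions_L2[OF test[of n]]] by simp
    show "integrable lebesgue (\<lambda>x. norm (indicator {a..b} x *\<^sub>R u x))"
      using set_integrable_L2[OF u, of "{a..b}"] unfolding set_integrable_def
      by (intro integrable_norm) auto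
    have "norm (u x * \<psi> n x) \<le> norm (indicator {a..b} x *\<^sub>R u x)" for n x
      by (cases "x \<in> {a..b}")
         (auto simp: \<psi>_def flat_exp_def abs_mult zero_less_mult_iff intro!: mult_left_le)
    then show "AE x in lebesgue. norm (u x * \<psi> n x) \<le> norm (indicator {a..b} x *\<^sub>R u x)" for n
      by simp
    \<comment> \<open>At the endpoints every bump vanishes but the indicator of the closed interval
      may be 1, so these two points are discarded.\<close>
    have "AE x in lebesgue. x \<noteq> a \<and> x \<noteq> b"
      using AE_completion[OF AE_lborel_singleton[of a]] AE_completion[OF AE_lborel_singleton[of b]]
      by eventually_elim auto
    then show "AE x in lebesgue. (\<lambda>n. u x * \<psi> n x) \<longlonglongrightarrow> indicator {a..b} x *\<^sub>R u x"
    proof eventually_elim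
      case (elim x)
      show ?case
      proof (cases "a < x \<and> x < b")
        case True
        then have pos: "(x - a) * (b - x) > 0"
          by simp
        have "(\<lambda>n. u x * exp (- inverse (real (Suc n)) / ((x - a) * (b - x)))) \<longlonglongrightarrow> u x * exp (- 0 / ((x - a) * (b - x)))"
          using pos by (intro tendsto_intros LIMSEQ_inverse_real_of_nat) auto
        then show ?thesis
          using True pos by (simp add: \<psi>_def flat_exp_def)
      next
        case False
        then have "\<psi> n x = 0" for n
          by (auto simp: \<psi>_def flat_exp_def zero_less_mult_iff)
        moreover have "x \<notin> {a..b}"
          using False elim by auto
        ultimately show ?thesis
          by simp
      qed
    qed
  qed (auto intro!: borel_measurable_lebesgue_indicator_Icc[OF L2_measurable[OF u], simplified])
  moreover have "(\<integral>x. u x * \<psi> n x \<partial>lebesgue) = 0" for n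
    using orth[OF test[of n]] by (simp add: L2_inner_def)
  ultimately show ?thesis
    by (simp add: set_lebesgue_integral_def LIMSEQ_const_iff)
qed

text \<open>Closed intervals generate the Borel sets, so on each bounded window the integrals over
  all Borel sets vanish, and uniqueness of densities applies. Countably many windows cover the
  line.\<close>

lemma AE_eq_0_if_interval_integrals_eq_0:
  fixes u :: "real \<Rightarrow> real"
  assumes int: "\<And>a b. set_integrable lebesgue {a..b} u"
    and zero: "\<And>a b. (LINT x:{a..b}|lebesgue. u x) = 0"
    and "u \<in> borel_measurable lebesgue"
  shows "AE x in lebesgue. u x = 0"
proof -
  \<comment> \<open>A Borel version of \<open>u\<close> allows the argument to run over Borel sets
    with \<open>lborel\<close>; the result returns to \<open>lebesgue\<close> through the
    completion.\<close>
  obtain v where v [measurable]: "v \<in> borel_measurable lborel" and uv: "AE x in lborel. u x = v x"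
    using completion_ex_borel_measurable_real[OF assms(3)] by auto
  have [measurable]: "v \<in> borel_measurable borel" "v \<in> borel_measurable lebesgue"
    using v measurable_completion[OF v] by simp_all
  note [measurable] = assms(3)
  have uv': "AE x in lebesgue. u x = v x"
    using uv by (rule AE_completion)
  have intv: "set_integrable lborel {a..b} v" for a b
  proof -
    have "integrable lebesgue (\<lambda>x. indicator {a..b} x *\<^sub>R v x)"
    proof (rule integrable_cong_AE_imp[OF int[unfolded set_integrable_def, of a b]])
      show "(\<lambda>x. indicator {a..b} x *\<^sub>R v x) \<in> borel_measurable lebesgue"
        by (rule borel_measurable_lebesgue_indicator_Icc) fact
    qed (use uv' in \<open>auto elim!: eventually_mono\<close>)
    then show ?thesis
      by (simp add: set_integrable_def integrable_completion)
  qed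
  have zerov: "(LINT x:{a..b}|lborel. v x) = 0" for a b
  proof -
    have "(LINT x:{a..b}|lborel. v x) = (LINT x:{a..b}|lebesgue. v x)"
      by (simp add: set_lebesgue_integral_def integral_completion)
    also have "\<dots> = (LINT x:{a..b}|lebesgue. u x)"
      unfolding set_lebesgue_integral_def
    proof (rule integral_cong_AE)
      show "(\<lambda>x. indicator {a..b} x *\<^sub>R u x) \<in> borel_measurable lebesgue"
        "(\<lambda>x. indicator {a..b} x *\<^sub>R v x) \<in> borel_measurable lebesgue"
        by (rule borel_measurable_lebesgue_indicator_Icc, fact)+
    qed (use uv' in \<open>auto elim!: eventually_mono\<close>)
    finally show ?thesis
      using zero by simp
  qed
  \<comment> \<open>\<open>v\<close> is only locally integrable, whereas the comparison of densities
    needs integrability on the whole line; hence the truncation.\<close>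
  have "AE x in lborel. indicator {- real N..real N} x * v x = 0" for N
  proof (rule density_unique_real)
    let ?v = "\<lambda>x. indicator {- real N..real N} x * v x"
    show i: "integrable lborel ?v"
      using intv[of "- real N" "real N"] by (simp add: set_integrable_def)
    have si: "set_integrable lborel A ?v" if "A \<in> sets borel" for A
      using i that unfolding set_integrable_def by (intro integrable_mult_indicator) auto
    fix A :: "real set" assume "A \<in> sets lborel"
    then have "A \<in> sets borel" by simp
    \<comment> \<open>Intervals meet the window in an interval, complements reduce to the total
      integral over the window, and disjoint unions follow from countable additivity.\<close>
    then have "(LINT x:A|lborel. ?v x) = 0"
    proof (induction A rule: borel_set_induct)
      case empty
      then show ?case by (simp add: set_lebesgue_integral_def)
    next
      case (interval a b)
      have "(LINT x:{a..b}|lborel. ?v x) = (LINT x:{max a (- real N)..min b (real N)}|lborel. v x)"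
        unfolding set_lebesgue_integral_def
        by (rule Bochner_Integration.integral_cong) (auto simp: indicator_def)
      then show ?case using zerov by simp
    next
      case (compl A)
      have "(LINT x:A \<union> - A|lborel. ?v x) = (LINT x:A|lborel. ?v x) + (LINT x:- A|lborel. ?v x)"
        using compl by (intro set_integral_Un si) auto
      moreover have "(LINT x:A \<union> - A|lborel. ?v x) = (LINT x:{- real N..real N}|lborel. v x)"
        by (simp add: set_lebesgue_integral_def)
      ultimately show ?case using compl zerov by simp
    next
      case (union f)
      have "(LINT x:(\<Union>i. f i)|lborel. ?v x) = (\<Sum>i. LINT x:f i|lborel. ?v x)"
        using union by (intro lebesgue_integral_countable_add si) (auto simp: disjoint_family_on_def)
      then show ?case using union by simp
    qed
    then show "(LINT x:A|lborel. ?v x) = (LINT x:A|lborel. 0)"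
      by (simp add: set_lebesgue_integral_def)
  qed simp
  then have "AE x in lborel. \<forall>N. indicator {- real N..real N} x * v x = 0"
    unfolding AE_all_countable ..
  then have "AE x in lborel. v x = 0"
  proof eventually_elim
    case (elim x)
    obtain N where "\<bar>x\<bar> \<le> real N"
      using real_arch_simple by blast
    then have "x \<in> {- real N..real N}" by auto
    then show ?case using elim by (metis indicator_simps(1) mult_1)
  qed
  then have "AE x in lebesgue. v x = 0"
    by (rule AE_completion)
  with uv' show ?thesis
    by eventually_elim simp
qed

lemma has_L2_weak_deriv_unique:
  assumes "has_L2_weak_deriv j f g" "has_L2_weak_deriv j f g'"
  shows "AE x in lebesgue. g x = g' x"
proof -
  let ?u = "\<lambda>x. g x - g' x"
  note gL2 = assms[THEN has_L2_weak_deriv_L2(2)]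
  have u: "?u \<in> L2"
    using gL2 by (rule L2_diff)
  have "L2_inner ?u \<psi> = 0" if "\<psi> \<in> test_functions" for \<psi>
  proof -
    have "(- 1) ^ j * L2_inner g \<psi> = (- 1) ^ j * L2_inner g' \<psi>"
      using assms that by (simp add: has_L2_weak_deriv_iff)
    then show ?thesis
      using gL2 that by (simp add: L2_inner_diff_left test_functions_L2)
  qed
  then have "AE x in lebesgue. ?u x = 0"
    using u by (intro AE_eq_0_if_interval_integrals_eq_0
        set_integral_eq_0_if_orthogonal_test_functions set_integrable_L2 L2_measurable) auto
  then show ?thesis by simp
qed

text \<open>Frees inner products from the choice made in \<open>weak_deriv\<close>: any known weak
  derivatives may stand in for the chosen representatives.\<close>

lemma L2_inner_weak_deriv:
  assumes "has_L2_weak_deriv i f f'" "has_L2_weak_deriv j g g'"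
  shows "L2_inner (weak_deriv i f) (weak_deriv j g) = L2_inner f' g'"
proof -
  have wd: "has_L2_weak_deriv i f (weak_deriv i f)" "has_L2_weak_deriv j g (weak_deriv j g)"
    unfolding weak_deriv_def by (rule someI[of "has_L2_weak_deriv i f"], fact)
      (rule someI[of "has_L2_weak_deriv j g"], fact)
  note [measurable] = wd[THEN has_L2_weak_deriv_L2(2), THEN L2_measurable]
    assms[THEN has_L2_weak_deriv_L2(2), THEN L2_measurable]
  show ?thesis
    unfolding L2_inner_def
  proof (rule integral_cong_AE)
    show "AE x in lebesgue. weak_deriv i f x * weak_deriv j g x = f' x * g' x"
      using has_L2_weak_deriv_unique[OF wd(1) assms(1)] has_L2_weak_deriv_unique[OF wd(2) assms(2)]
      by eventually_elim simp
  qed simp_all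
qed


section \<open>Series in the mean\<close>

text \<open>Cauchy-Schwarz for series with weights \<open>w\<close>. The summand 1 keeps the
  constant positive, so that one may divide by it even when all weights vanish.\<close>

lemma weighted_suminf_squared_le:
  fixes w a :: "nat \<Rightarrow> real"
  assumes w: "\<And>n. 0 \<le> w n" "summable w" and wa2: "summable (\<lambda>n. w n * (a n)\<^sup>2)"
  shows "summable (\<lambda>n. norm (a n * w n))"
    and "(\<Sum>n. a n * w n)\<^sup>2 \<le> (suminf w + 1) * (\<Sum>n. w n * (a n)\<^sup>2)"
proof -
  have bound: "norm (a n * w n) \<le> w n + w n * (a n)\<^sup>2" for n
  proof -
    have "2 * \<bar>a n\<bar> \<le> 1 + (a n)\<^sup>2"
      using sum_squares_bound[of 1 "\<bar>a n\<bar>"] by simp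
    then have "\<bar>a n\<bar> * w n \<le> (1 + (a n)\<^sup>2) * w n"
      using w(1)[of n] by (intro mult_right_mono) auto
    then show ?thesis
      using w(1)[of n] by (simp add: abs_mult algebra_simps)
  qed
  show sn: "summable (\<lambda>n. norm (a n * w n))"
    by (rule summable_comparison_test'[where g = "\<lambda>n. w n + w n * (a n)\<^sup>2"])
       (use bound w wa2 in \<open>auto intro: summable_add\<close>)
  define W S Q where "W = suminf w" and "S = (\<Sum>n. a n * w n)" and "Q = (\<Sum>n. w n * (a n)\<^sup>2)"
  have W: "0 \<le> W"
    unfolding W_def using w by (intro suminf_nonneg)
  \<comment> \<open>The minimiser of \<open>Q - 2 * t * S + t\<^sup>2 * (W + 1)\<close>. The bound
    comes from summing the nonnegative terms \<open>w n * (a n - t)\<^sup>2\<close>.\<close>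
  define t where "t = S / (W + 1)"
  have sums: "(\<lambda>n. w n * (a n)\<^sup>2 - 2 * t * (a n * w n) + t\<^sup>2 * w n) sums (Q - 2 * t * S + t\<^sup>2 * W)"
    unfolding W_def S_def Q_def using sn
    by (intro sums_add sums_diff sums_mult summable_sums w wa2) (rule summable_norm_cancel)
  have "0 \<le> Q - 2 * t * S + t\<^sup>2 * W"
  proof (rule sums_le[OF _ sums_zero sums])
    fix n
    have "w n * (a n)\<^sup>2 - 2 * t * (a n * w n) + t\<^sup>2 * w n = w n * (a n - t)\<^sup>2"
      by (simp add: power2_diff algebra_simps)
    then show "0 \<le> w n * (a n)\<^sup>2 - 2 * t * (a n * w n) + t\<^sup>2 * w n"
      using w(1)[of n] by simp
  qed
  also have "\<dots> \<le> Q - 2 * t * S + t\<^sup>2 * (W + 1)"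
    by (simp add: algebra_simps)
  also have "t\<^sup>2 * (W + 1) = t * S"
    using W by (simp add: t_def power2_eq_square)
  also have "Q - 2 * t * S + t * S = Q - S\<^sup>2 / (W + 1)"
    by (simp add: t_def power2_eq_square)
  finally show "S\<^sup>2 \<le> (W + 1) * Q"
    using W by (simp add: field_simps)
qed

text \<open>Summable weights and uniformly bounded norms make the weighted squares summable almost
  everywhere with integrable sum. Weighted Cauchy-Schwarz then dominates the square of the series,
  and pairing with \<open>g\<close> may be done term by term.\<close>

lemma L2_series:
  fixes f :: "nat \<Rightarrow> real \<Rightarrow> real" and w :: "nat \<Rightarrow> real"
  assumes w: "\<And>n. 0 \<le> w n" "summable w"
    and f: "\<And>n. f n \<in> L2" "\<And>n. L2_inner (f n) (f n) \<le> C"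
  defines "F \<equiv> \<lambda>x. \<Sum>\<^sub>\<infinity>n. f n x * w n"
  shows "F \<in> L2" and "g \<in> L2 \<Longrightarrow> (\<lambda>n. w n * L2_inner (f n) g) sums L2_inner F g"
proof -
  note [measurable] = L2_measurable[OF f(1)]
  have int: "integrable lebesgue (\<lambda>x. w n * (f n x)\<^sup>2)" for n
    using f by (simp add: L2_square_integrable)
  have le: "(\<integral>x. w n * (f n x)\<^sup>2 \<partial>lebesgue) \<le> w n * C" for n
    using f(2)[of n] w(1)[of n] by (simp add: L2_inner_def power2_eq_square mult_left_mono)
  have summable_int: "summable (\<lambda>n. \<integral>x. w n * (f n x)\<^sup>2 \<partial>lebesgue)"
    by (rule summable_comparison_test'[where g = "\<lambda>n. w n * C"])
       (use le w in \<open>auto intro: summable_mult2\<close>)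
  \<comment> \<open>Integrating the nonnegative series termwise in \<open>ennreal\<close> shows that
    it is finite almost everywhere, before anything is known about convergence of the real
    series.\<close>
  have "(\<integral>\<^sup>+x. (\<Sum>n. ennreal (w n * (f n x)\<^sup>2)) \<partial>lebesgue)
      = (\<Sum>n. \<integral>\<^sup>+x. ennreal (w n * (f n x)\<^sup>2) \<partial>lebesgue)"
    by (rule nn_integral_suminf) simp
  also have "\<dots> = (\<Sum>n. ennreal (\<integral>x. w n * (f n x)\<^sup>2 \<partial>lebesgue))"
    using w int by (subst nn_integral_eq_integral) auto
  also have "\<dots> \<noteq> \<infinity>"
    using w summable_int by (simp add: ennreal_suminf_neq_top)
  finally have "AE x in lebesgue. (\<Sum>n. ennreal (w n * (f n x)\<^sup>2)) \<noteq> \<infinity>"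
    by (intro nn_integral_PInf_AE) auto
  then have AE1: "AE x in lebesgue. summable (\<lambda>n. w n * (f n x)\<^sup>2)"
    by eventually_elim (use w in \<open>auto intro!: summable_suminf_not_top\<close>)
  have int_sum: "integrable lebesgue (\<lambda>x. \<Sum>n. w n * (f n x)\<^sup>2)"
    using int AE1 summable_int w by (intro integrable_suminf) (auto simp: abs_mult)
  \<comment> \<open>The ordered sum \<open>G\<close> is measurable as a countable limit. It agrees
    almost everywhere with the unordered sum \<open>F\<close>, which thereby becomes measurable
    too.\<close>
  define G where "G = (\<lambda>x. \<Sum>n. f n x * w n)"
  have [measurable]: "G \<in> borel_measurable lebesgue"
    unfolding G_def by measurable
  have AE2: "AE x in lebesgue. G x = F x"
    using AE1
  proof eventually_elim
    case (elim x)
    note sn = weighted_suminf_squared_le(1)[OF w elim]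
    then have "((\<lambda>n. f n x * w n) has_sum G x) UNIV"
      unfolding G_def by (intro norm_summable_imp_has_sum summable_sums summable_norm_cancel[OF sn])
    then show ?case
      unfolding F_def by (simp add: infsumI)
  qed
  have F_meas [measurable]: "F \<in> borel_measurable lebesgue"
    by (rule borel_measurable_AE[OF _ AE2]) simp
  have "integrable lebesgue (\<lambda>x. (F x)\<^sup>2)"
  proof (rule Bochner_Integration.integrable_bound)
    show "integrable lebesgue (\<lambda>x. (suminf w + 1) * (\<Sum>n. w n * (f n x)\<^sup>2))"
      using int_sum by simp
    show "AE x in lebesgue. norm ((F x)\<^sup>2) \<le> norm ((suminf w + 1) * (\<Sum>n. w n * (f n x)\<^sup>2))"
      using AE1 AE2
    proof eventually_elim
      case (elim x)
      then show ?case
        using weighted_suminf_squared_le(2)[OF w elim(1)] by (simp add: G_def)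
    qed
  qed simp
  then show "F \<in> L2"
    by (simp add: L2_def)
  assume g: "g \<in> L2"
  note [measurable] = L2_measurable[OF g]
  have intg: "integrable lebesgue (\<lambda>x. f n x * w n * g x)" for n
    using integrable_mult_left[OF L2_mult_integrable[OF f(1)[of n] g], of "w n"] by (simp add: mult_ac)
  have "(\<lambda>n. \<integral>x. f n x * w n * g x \<partial>lebesgue) sums (\<integral>x. (\<Sum>n. f n x * w n * g x) \<partial>lebesgue)"
  proof (rule sums_integral[OF intg])
    show "AE x in lebesgue. summable (\<lambda>n. norm (f n x * w n * g x))"
      using AE1
    proof eventually_elim
      case (elim x)
      from summable_mult2[OF weighted_suminf_squared_le(1)[OF w elim], of "\<bar>g x\<bar>"]
      show ?case by (simp add: abs_mult)
    qed
    \<comment> \<open>The elementary bound of a product by the sum of the squares yields the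
      summable majorant \<open>w n * (C + L2_inner g g)\<close>.\<close>
    show "summable (\<lambda>n. \<integral>x. norm (f n x * w n * g x) \<partial>lebesgue)"
    proof (rule summable_comparison_test')
      show "summable (\<lambda>n. w n * (C + L2_inner g g))"
        using w by (intro summable_mult2)
      fix n
      have "(\<integral>x. norm (f n x * w n * g x) \<partial>lebesgue) \<le> (\<integral>x. w n * (f n x)\<^sup>2 + w n * (g x)\<^sup>2 \<partial>lebesgue)"
      proof (rule integral_mono)
        show "integrable lebesgue (\<lambda>x. norm (f n x * w n * g x))"
          using intg by (rule integrable_norm)
        show "integrable lebesgue (\<lambda>x. w n * (f n x)\<^sup>2 + w n * (g x)\<^sup>2)"
          using f g by (simp add: L2_square_integrable)
        fix x
        have "\<bar>f n x\<bar> * \<bar>g x\<bar> \<le> (f n x)\<^sup>2 + (g x)\<^sup>2"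
          using abs_mult_le_sum_squares[of "f n x" "g x"] by (simp add: abs_mult)
        from mult_left_mono[OF this w(1)[of n]]
        show "norm (f n x * w n * g x) \<le> w n * (f n x)\<^sup>2 + w n * (g x)\<^sup>2"
          using w(1)[of n] by (simp add: abs_mult algebra_simps)
      qed
      also have "\<dots> = w n * (L2_inner (f n) (f n) + L2_inner g g)"
        using f g by (simp add: L2_inner_def L2_mult_integrable power2_eq_square distrib_left)
      also have "\<dots> \<le> w n * (C + L2_inner g g)"
        using f(2)[of n] w(1)[of n] by (intro mult_left_mono) auto
      finally show "norm (\<integral>x. norm (f n x * w n * g x) \<partial>lebesgue) \<le> w n * (C + L2_inner g g)"
        by simp
    qed
  qed
  also have "(\<lambda>n. \<integral>x. f n x * w n * g x \<partial>lebesgue) = (\<lambda>n. w n * L2_inner (f n) g)"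
  proof
    fix n
    have "(\<integral>x. f n x * w n * g x \<partial>lebesgue) = (\<integral>x. w n * (f n x * g x) \<partial>lebesgue)"
      by (rule Bochner_Integration.integral_cong) auto
    then show "(\<integral>x. f n x * w n * g x \<partial>lebesgue) = w n * L2_inner (f n) g"
      by (simp add: L2_inner_def)
  qed
  also have "(\<integral>x. (\<Sum>n. f n x * w n * g x) \<partial>lebesgue) = L2_inner F g"
    unfolding L2_inner_def
  proof (rule integral_cong_AE)
    show "AE x in lebesgue. (\<Sum>n. f n x * w n * g x) = F x * g x"
      using AE1 AE2
    proof eventually_elim
      case (elim x)
      from suminf_mult2[OF summable_norm_cancel[OF weighted_suminf_squared_le(1)[OF w elim(1)]], of "g x"]
      show ?case using elim(2) by (simp add: G_def)
    qed
  qed simp_all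
  finally show "(\<lambda>n. w n * L2_inner (f n) g) sums L2_inner F g" .
qed

text \<open>Pairing with a fixed test function may be done termwise on both sides; the two numerical
  series agree term by term, hence so do their sums.\<close>

lemma has_L2_weak_deriv_series:
  fixes f g :: "nat \<Rightarrow> real \<Rightarrow> real" and w :: "nat \<Rightarrow> real"
  assumes w: "\<And>n. 0 \<le> w n" "summable w"
    and fg: "\<And>n. has_L2_weak_deriv j (f n) (g n)"
    and C: "\<And>n. L2_inner (f n) (f n) \<le> C" "\<And>n. L2_inner (g n) (g n) \<le> C'"
  shows "has_L2_weak_deriv j (\<lambda>x. \<Sum>\<^sub>\<infinity>n. f n x * w n) (\<lambda>x. \<Sum>\<^sub>\<infinity>n. g n x * w n)"
  unfolding has_L2_weak_deriv_iff
proof (intro conjI ballI)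
  note F = L2_series[OF w, where f = f and C = C, OF has_L2_weak_deriv_L2(1)[OF fg] C(1)]
  note G = L2_series[OF w, where f = g and C = C', OF has_L2_weak_deriv_L2(2)[OF fg] C(2)]
  show "(\<lambda>x. \<Sum>\<^sub>\<infinity>n. f n x * w n) \<in> L2" "(\<lambda>x. \<Sum>\<^sub>\<infinity>n. g n x * w n) \<in> L2"
    by (rule F(1), rule G(1))
  fix \<psi> assume \<psi>: "\<psi> \<in> test_functions"
  have "(\<lambda>n. w n * L2_inner (f n) ((deriv ^^ j) \<psi>)) = (\<lambda>n. (- 1) ^ j * (w n * L2_inner (g n) \<psi>))"
    using fg \<psi> by (simp add: has_L2_weak_deriv_iff mult_ac)
  with F(2)[OF test_functions_higher_deriv_L2[OF \<psi>, of j]]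
    sums_mult[OF G(2)[OF test_functions_L2[OF \<psi>]], of "(- 1) ^ j"]
  show "L2_inner (\<lambda>x. \<Sum>\<^sub>\<infinity>n. f n x * w n) ((deriv ^^ j) \<psi>)
      = (- 1) ^ j * L2_inner (\<lambda>x. \<Sum>\<^sub>\<infinity>n. g n x * w n) \<psi>"
    by (simp add: sums_unique2)
qed


section \<open>The discretised operator\<close>

lemma diff_quot_L2_weak_deriv:
  assumes "has_L2_weak_deriv j f g"
  shows "has_L2_weak_deriv j (diff_quot d f) (diff_quot d g)"
proof -
  have "diff_quot d u = (\<lambda>x. inverse d * (u (x + d) - u x))" for u
    by (simp add: diff_quot_def divide_inverse mult.commute fun_eq_iff)
  then show ?thesis
    using assms by (auto intro!: has_L2_weak_deriv_cmult has_L2_weak_deriv_diff has_L2_weak_deriv_translate)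
qed

lemma diff_quot_diff_quot:
  assumes "h \<noteq> 0"
  shows "diff_quot (- h) (diff_quot h f) x = inverse (h\<^sup>2) * (f (x + h) - 2 * f x + f (x - h))"
  using assms by (simp add: diff_quot_def field_simps power2_eq_square)

lemma J1_L2_weak_deriv:
  assumes "has_L2_weak_deriv j f g"
  shows "has_L2_weak_deriv j (J1 \<nu> h f) (J1 \<nu> h g)"
proof -
  have "J1 \<nu> h u = (\<lambda>x. \<Sum>k\<in>near_idx h. zeta \<nu> h k *
     (\<Sum>l<nat \<bar>k\<bar>. theta k l * diff_quot (- h) (diff_quot h u) (x + of_int (sgn k) * real l * h)))" for u
    by (simp add: J1_def fun_eq_iff)
  then show ?thesis
    using assms by (auto intro!: has_L2_weak_deriv_sum has_L2_weak_deriv_cmult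
        has_L2_weak_deriv_translate[of j "diff_quot (- h) (diff_quot h f)"] diff_quot_L2_weak_deriv)
qed

section \<open>Dissipativity of the near part\<close>

text \<open>The integrand is affine, so the value is the length \<open>1 / n\<close> of the interval
  times \<open>1 - t\<close> at its midpoint, where \<open>n = nat \<bar>k\<bar>\<close>.\<close>

lemma theta_eq:
  assumes "k \<noteq> 0"
  shows "theta k l = (2 * real (nat \<bar>k\<bar>) - 2 * real l - 1) / (2 * (real (nat \<bar>k\<bar>))\<^sup>2)"
proof -
  define n where "n = real (nat \<bar>k\<bar>)"
  have n: "n > 0" "\<bar>real_of_int k\<bar> = n"
    using assms by (simp_all add: n_def)
  have "theta k l = (\<integral>t. (1 - t) * indicator {real l / n..(real l + 1) / n} t \<partial>lborel)"
    by (simp add: theta_def set_lebesgue_integral_def n mult.commute)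
  also have "\<dots> = ((real l + 1) / n - ((real l + 1) / n)\<^sup>2 / 2) - (real l / n - (real l / n)\<^sup>2 / 2)"
    by (rule integral_FTC_Icc_real[where F = "\<lambda>t. t - t\<^sup>2 / 2"])
       (use n in \<open>auto intro!: derivative_eq_intros simp: divide_right_mono\<close>)
  also have "\<dots> = (2 * n - 2 * real l - 1) / (2 * n\<^sup>2)"
    using n by (simp add: field_simps power2_eq_square)
  finally show ?thesis
    by (simp add: n_def)
qed

text \<open>Two summations by parts: the right-hand side is a combination of the autocorrelations
  \<open>c m\<close> whose coefficients add up to \<open>0\<close>, the only negative one being that of \<open>c 0\<close>.\<close>

lemma sum_second_differences:
  fixes c :: "int \<Rightarrow> real"
  assumes "c (-1) = c 1" "n > 0"
  shows "(\<Sum>l<n. (2 * real n - 2 * real l - 1) * (c (int l + 1) - 2 * c (int l) + c (int l - 1)))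
    = c (int n) + c (int n - 1) + (2 * real n - 1) * c 1 - (2 * real n + 1) * c 0"
proof -
  define D where "D l = c (int l + 1) - 2 * c (int l) + c (int l - 1)" for l
  \<comment> \<open>The second differences telescope; the contribution at the lower end is
    \<open>c 0 - c (-1)\<close>, which the symmetry assumption rewrites with
    \<open>c 1\<close>.\<close>
  have D: "(\<Sum>l<m. D l) = c (int m) - c (int m - 1) + c 1 - c 0" for m
    by (induction m) (simp_all add: D_def assms add.commute)
  have "(\<Sum>l<n. (2 * real n - 2 * real l - 1) * D l)
    = c (int n) + c (int n - 1) + (2 * real n - 1) * c 1 - (2 * real n + 1) * c 0" for n
  proof (induction n)
    case (Suc n)
    \<comment> \<open>Passing from \<open>n\<close> to \<open>Suc n\<close> raises every old weight
      by 2 and adds the index \<open>n\<close> with weight 1.\<close>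
    have "(\<Sum>l<Suc n. (2 * real (Suc n) - 2 * real l - 1) * D l)
      = (\<Sum>l<n. (2 * real n - 2 * real l - 1) * D l + 2 * D l) + D n"
      by (simp add: algebra_simps)
    also have "\<dots> = (\<Sum>l<n. (2 * real n - 2 * real l - 1) * D l) + 2 * (\<Sum>l<n. D l) + D n"
      by (simp add: sum.distrib sum_distrib_left)
    finally show ?case
      unfolding Suc.IH D by (simp add: D_def algebra_simps)
  qed (simp add: assms)
  then show ?thesis
    by (simp add: D_def)
qed

lemma J1_dissipative:
  assumes f: "f \<in> L2" and h: "h > 0"
  shows "L2_inner (J1 \<nu> h f) f \<le> 0"
proof -
  define c where "c m = L2_inner (\<lambda>x. f (x + of_int m * h)) f" for m :: int
  have c_even: "c (- m) = c m" for m
    using L2_autocorrelation_even[of f "of_int m * h"] by (simp add: c_def)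
  have c_le: "c m \<le> c 0" for m
    using L2_autocorrelation_le[OF f] by (simp add: c_def)
  let ?D = "\<lambda>d x. diff_quot (- h) (diff_quot h f) (x + d)"
  have D_L2: "?D d \<in> L2" for d
    by (rule L2_translate)
       (rule has_L2_weak_deriv_L2[OF diff_quot_L2_weak_deriv[OF diff_quot_L2_weak_deriv[OF has_L2_weak_deriv_0[OF f]]]])
  \<comment> \<open>Pairing the second difference of \<open>f\<close> with \<open>f\<close> gives
    the second difference of the autocorrelation on the lattice of step \<open>h\<close>.\<close>
  have D_inner: "L2_inner (?D (of_int m * h)) f = inverse (h\<^sup>2) * (c (m + 1) - 2 * c m + c (m - 1))" for m
  proof -
    have "?D (of_int m * h) = (\<lambda>x. inverse (h\<^sup>2) *
        ((f (x + of_int (m + 1) * h) - 2 * f (x + of_int m * h)) + f (x + of_int (m - 1) * h)))"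
      using h by (simp add: diff_quot_diff_quot fun_eq_iff algebra_simps)
    then show ?thesis
      using f by (simp add: c_def L2_inner_cmult_left L2_inner_add_left L2_inner_diff_left
          L2_translate L2_cmult L2_diff)
  qed
  have inner: "(\<Sum>l<nat \<bar>k\<bar>. theta k l * L2_inner (?D (of_int (sgn k) * real l * h)) f) \<le> 0"
    if "k \<noteq> 0" for k
  proof -
    define n where "n = nat \<bar>k\<bar>"
    have n: "n > 0"
      using that by (simp add: n_def)
    have D_eq: "L2_inner (?D (of_int (sgn k) * real l * h)) f
        = inverse (h\<^sup>2) * (c (int l + 1) - 2 * c (int l) + c (int l - 1))" for l
    proof (cases "k > 0")
      case True
      then show ?thesis using D_inner[of "int l"] by simp
    next
      \<comment> \<open>For negative \<open>k\<close> the shifts run to the left. Evenness of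
        \<open>c\<close> reflects them and exchanges the two outer terms of the symmetric second
        difference.\<close>
      case False
      have "c (- int l + 1) = c (int l - 1)"
        using c_even[of "int l - 1"] by (simp only: minus_diff_eq uminus_add_conv_diff)
      moreover have "c (- int l - 1) = c (int l + 1)"
        using c_even[of "int l + 1"] by (simp only: minus_add_distrib diff_conv_add_uminus)
      moreover have "of_int (- int l) * h = of_int (sgn k) * real l * h"
        using False that by simp
      ultimately have "L2_inner (?D (of_int (sgn k) * real l * h)) f
          = inverse (h\<^sup>2) * (c (int l - 1) - 2 * c (int l) + c (int l + 1))"
        using D_inner[of "- int l"] c_even[of "int l"] by (simp only:)
      then show ?thesis
        by (rule trans) simp
    qed
    have factor: "a / (2 * b) * (inverse d * e) = inverse (2 * b * d) * (a * e)" for a b d e :: real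
      by (cases "b = 0 \<or> d = 0") (auto simp: field_simps)
    have term_eq: "theta k l * L2_inner (?D (of_int (sgn k) * real l * h)) f = inverse (2 * (real n)\<^sup>2 * h\<^sup>2) *
        ((2 * real n - 2 * real l - 1) * (c (int l + 1) - 2 * c (int l) + c (int l - 1)))" for l
      unfolding D_eq theta_eq[OF that] n_def by (rule factor)
    have "(\<Sum>l<n. theta k l * L2_inner (?D (of_int (sgn k) * real l * h)) f)
      = inverse (2 * (real n)\<^sup>2 * h\<^sup>2) *
        (\<Sum>l<n. (2 * real n - 2 * real l - 1) * (c (int l + 1) - 2 * c (int l) + c (int l - 1)))"
      unfolding sum_distrib_left by (rule sum.cong[OF refl term_eq])
    also have "(\<Sum>l<n. (2 * real n - 2 * real l - 1) * (c (int l + 1) - 2 * c (int l) + c (int l - 1)))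
      = c (int n) + c (int n - 1) + (2 * real n - 1) * c 1 - (2 * real n + 1) * c 0"
      using n c_even[of 1] by (intro sum_second_differences) auto
    also have "inverse (2 * (real n)\<^sup>2 * h\<^sup>2) * \<dots> \<le> 0"
    proof (rule mult_nonneg_nonpos)
      \<comment> \<open>The positive coefficients 1, 1 and \<open>2 * real n - 1\<close> add up to
        \<open>2 * real n + 1\<close>, and each value of \<open>c\<close> is at most
        \<open>c 0\<close>.\<close>
      have "(2 * real n - 1) * c 1 \<le> (2 * real n - 1) * c 0"
        using n c_le by (intro mult_left_mono) auto
      then show "c (int n) + c (int n - 1) + (2 * real n - 1) * c 1 - (2 * real n + 1) * c 0 \<le> 0"
        using c_le[of "int n"] c_le[of "int n - 1"] by (simp add: algebra_simps)
    qed simp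
    finally show ?thesis
      by (simp add: n_def)
  qed
  have "J1 \<nu> h f = (\<lambda>x. \<Sum>k\<in>near_idx h. zeta \<nu> h k *
     (\<Sum>l<nat \<bar>k\<bar>. theta k l * ?D (of_int (sgn k) * real l * h) x))"
    by (simp add: J1_def fun_eq_iff)
  then have "L2_inner (J1 \<nu> h f) f = (\<Sum>k\<in>near_idx h. zeta \<nu> h k *
     (\<Sum>l<nat \<bar>k\<bar>. theta k l * L2_inner (?D (of_int (sgn k) * real l * h)) f))"
    using f D_L2 by (simp add: L2_inner_sum_left L2_inner_cmult_left L2_sum L2_cmult)
  also have "\<dots> \<le> 0"
  proof (rule sum_nonpos, rule mult_nonneg_nonpos)
    \<comment> \<open>The Bochner integral of a nonnegative function is nonnegative, its value being
      0 if the function is not integrable.\<close>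
    show "0 \<le> zeta \<nu> h k" for k
      by (simp add: zeta_def set_lebesgue_integral_def)
  qed (simp add: near_idx_def inner)
  finally show ?thesis .
qed

section \<open>The far part\<close>

text \<open>Since \<open>k\<close> can be recovered from \<open>z\<close>, the far cells are disjoint.\<close>

lemma cell_far_idx:
  assumes "h \<in> mesh_sizes" "k \<in> far_idx h" "z \<in> cell h k"
  shows "1 \<le> \<bar>z\<bar>" "k = (if 0 < z then \<lceil>z / h\<rceil> else \<lfloor>z / h\<rfloor>)"
proof -
  obtain n where n: "h = 1 / real n" "n \<ge> 1"
    using assms(1) by (auto simp: mesh_sizes_def)
  have h: "h > 0" "real n * h = 1"
    using n by simp_all
  have "\<not> real_of_int \<bar>k\<bar> \<le> real n \<or> k = 0" "k \<noteq> 0"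
    using assms(2) n by (auto simp: far_idx_def near_idx_def)
  \<comment> \<open>Since \<open>1 / h\<close> is the integer \<open>n\<close>, a far index exceeds
    it by at least one. Even the endpoint of the cell nearer to 0 is therefore at distance at least
    \<open>real n * h = 1\<close>.\<close>
  then have kn: "\<bar>k\<bar> > int n"
    by linarith
  have "1 \<le> \<bar>z\<bar> \<and> k = (if 0 < z then \<lceil>z / h\<rceil> else \<lfloor>z / h\<rfloor>)"
  proof (cases "k \<ge> 1")
    case True
    then have z: "(of_int k - 1) * h < z" "z \<le> of_int k * h"
      using assms(3) by (auto simp: cell_def)
    have "real n * h \<le> (of_int k - 1) * h"
      using kn True h by (intro mult_right_mono) linarith+
    then have "1 < z"
      using z h by linarith
    \<comment> \<open>Positive cells contain their right endpoint, so \<open>k\<close> is a ceiling;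
      negative cells contain their left endpoint, so it is a floor below.\<close>
    moreover have "k = \<lceil>z / h\<rceil>"
      using z h by (intro ceiling_unique[symmetric]) (simp_all add: field_simps)
    ultimately show ?thesis by simp
  next
    case False
    then have z: "of_int k * h \<le> z" "z < (of_int k + 1) * h"
      using assms(3) by (auto simp: cell_def)
    have "(of_int k + 1) * h \<le> - real n * h"
      using kn False h by (intro mult_right_mono) linarith+
    then have "z < - 1"
      using z h by linarith
    moreover have "k = \<lfloor>z / h\<rfloor>"
      using z h by (intro floor_unique[symmetric]) (simp_all add: field_simps)
    ultimately show ?thesis by simp
  qed
  then show "1 \<le> \<bar>z\<bar>" "k = (if 0 < z then \<lceil>z / h\<rceil> else \<lfloor>z / h\<rfloor>)"
    by blast+
qed

lemma cell_borel: "cell h k \<in> sets borel"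
  by (simp add: cell_def)

text \<open>An enumeration of the far cells by natural numbers, with the empty set at the other
  indices, so that results on series over \<open>nat\<close> apply.\<close>

definition far_weight :: "real measure \<Rightarrow> real \<Rightarrow> nat \<Rightarrow> real" where
  "far_weight \<nu> h n = measure \<nu> (if int_decode n \<in> far_idx h then cell h (int_decode n) else {})"

lemma far_weight_nonneg: "0 \<le> far_weight \<nu> h n"
  by (simp add: far_weight_def)

text \<open>The far cells are disjoint and lie in the set where
  \<open>1 \<le> \<bar>z\<bar>\<close>. There the integrand \<open>min 1 (z\<^sup>2)\<close> equals
  1, so the Levy condition makes their total mass finite.\<close>

lemma far_weight_summable:
  assumes "levy_measure \<nu>" "h \<in> mesh_sizes"
  shows "summable (far_weight \<nu> h)"
proof -
  have sets [measurable_cong]: "sets \<nu> = sets borel" and fin: "(\<integral>\<^sup>+z. ennreal (min 1 (z\<^sup>2)) \<partial>\<nu>) < \<infinity>"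
    using assms(1) by (auto simp: levy_measure_def)
  define A where "A n = (if int_decode n \<in> far_idx h then cell h (int_decode n) else {})" for n
  have A: "range A \<subseteq> sets \<nu>"
    by (auto simp: A_def sets cell_borel)
  have disj: "disjoint_family A"
    unfolding disjoint_family_on_def
  proof (intro ballI impI equals0I)
    fix m n z assume "m \<noteq> n" "z \<in> A m \<inter> A n"
    then have "int_decode m = int_decode n"
      using cell_far_idx(2)[OF assms(2), of "int_decode m" z] cell_far_idx(2)[OF assms(2), of "int_decode n" z]
      by (simp add: A_def split: if_splits)
    with \<open>m \<noteq> n\<close> show False
      by (simp add: inj_eq[OF inj_int_decode])
  qed
  have "emeasure \<nu> (\<Union>n. A n) \<le> emeasure \<nu> {z. 1 \<le> \<bar>z\<bar>}"
  proof (rule emeasure_mono)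
    show "(\<Union>n. A n) \<subseteq> {z. 1 \<le> \<bar>z\<bar>}"
      using cell_far_idx(1)[OF assms(2)] by (auto simp: A_def split: if_splits)
    show "{z. 1 \<le> \<bar>z\<bar>} \<in> sets \<nu>"
      unfolding sets by measurable
  qed
  also have "\<dots> = (\<integral>\<^sup>+z. indicator {z. 1 \<le> \<bar>z\<bar>} z \<partial>\<nu>)"
    by (rule nn_integral_indicator[symmetric]) (unfold sets, measurable)
  also have "\<dots> \<le> (\<integral>\<^sup>+z. ennreal (min 1 (z\<^sup>2)) \<partial>\<nu>)"
  proof (rule nn_integral_mono)
    fix z :: real
    have "1 \<le> z\<^sup>2" if "1 \<le> \<bar>z\<bar>"
      using that power_mono[of 1 "\<bar>z\<bar>" 2] by simp
    then show "indicator {z. 1 \<le> \<bar>z\<bar>} z \<le> ennreal (min 1 (z\<^sup>2))"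
      by (auto simp: indicator_def min_def)
  qed
  finally have "emeasure \<nu> (\<Union>n. A n) \<noteq> \<infinity>"
    using fin by auto
  from measure_UNION[OF A disj this] show ?thesis
    unfolding far_weight_def A_def by (rule sums_summable)
qed

text \<open>Unordered sums are invariant under reindexing by a bijection, so the two sides agree at
  every \<open>x\<close>, including points where the series fails to converge.\<close>

lemma J2_eq_series:
  "J2 \<nu> h f = (\<lambda>x. \<Sum>\<^sub>\<infinity>n. (f (x + h * of_int (int_decode n)) - f x) * far_weight \<nu> h n)"
proof
  fix x
  let ?t = "\<lambda>k. (f (x + h * of_int k) - f x) * measure \<nu> (if k \<in> far_idx h then cell h k else {})"
  have "J2 \<nu> h f x = infsum ?t UNIV"
    unfolding J2_def by (rule infsum_cong_neutral) auto
  also have "\<dots> = (\<Sum>\<^sub>\<infinity>n. ?t (int_decode n))"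
    by (rule infsum_reindex_bij_betw[OF bij_int_decode, symmetric])
  finally show "J2 \<nu> h f x
      = (\<Sum>\<^sub>\<infinity>n. (f (x + h * of_int (int_decode n)) - f x) * far_weight \<nu> h n)"
    by (simp add: far_weight_def)
qed

lemma J2_L2_weak_deriv:
  assumes "levy_measure \<nu>" "h \<in> mesh_sizes" "has_L2_weak_deriv j f g"
  shows "has_L2_weak_deriv j (J2 \<nu> h f) (J2 \<nu> h g)"
  unfolding J2_eq_series
proof (rule has_L2_weak_deriv_series)
  show "summable (far_weight \<nu> h)"
    using assms(1,2) by (rule far_weight_summable)
  fix n
  let ?d = "h * of_int (int_decode n)"
  show "has_L2_weak_deriv j (\<lambda>x. f (x + ?d) - f x) (\<lambda>x. g (x + ?d) - g x)"
    by (intro has_L2_weak_deriv_diff has_L2_weak_deriv_translate assms(3))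
  show "L2_inner (\<lambda>x. f (x + ?d) - f x) (\<lambda>x. f (x + ?d) - f x) \<le> 4 * L2_inner f f"
    "L2_inner (\<lambda>x. g (x + ?d) - g x) (\<lambda>x. g (x + ?d) - g x) \<le> 4 * L2_inner g g"
    by (intro L2_translate_diff_le has_L2_weak_deriv_L2[OF assms(3)])+
qed (rule far_weight_nonneg)

lemma J2_dissipative:
  assumes "levy_measure \<nu>" "h \<in> mesh_sizes" and f: "f \<in> L2"
  shows "L2_inner (J2 \<nu> h f) f \<le> 0"
proof -
  let ?f = "\<lambda>n x. f (x + h * of_int (int_decode n)) - f x"
  have sums: "(\<lambda>n. far_weight \<nu> h n * L2_inner (?f n) f) sums L2_inner (J2 \<nu> h f) f"
    unfolding J2_eq_series
    by (rule L2_series(2)[OF far_weight_nonneg far_weight_summable[OF assms(1,2)] _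
          L2_translate_diff_le[OF f] f]) (intro L2_diff L2_translate f)
  \<comment> \<open>Each pairing is a value of the autocorrelation minus its value at 0.\<close>
  have nonpos: "far_weight \<nu> h n * L2_inner (?f n) f \<le> 0" for n
    using f L2_autocorrelation_le[OF f]
    by (intro mult_nonneg_nonpos) (simp_all add: far_weight_nonneg L2_inner_diff_left L2_translate)
  show ?thesis
    by (rule sums_le[OF nonpos sums sums_zero])
qed

section \<open>The full operator\<close>

lemma J_L2_weak_deriv:
  assumes "levy_measure \<nu>" "h \<in> mesh_sizes" "has_L2_weak_deriv j f g"
  shows "has_L2_weak_deriv j (J \<nu> h f) (J \<nu> h g)"
  using has_L2_weak_deriv_add[OF J1_L2_weak_deriv[OF assms(3)] J2_L2_weak_deriv[OF assms]]
  by (simp add: J_def[abs_def])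

lemma J_dissipative:
  assumes "levy_measure \<nu>" "h \<in> mesh_sizes" and f: "f \<in> L2"
  shows "L2_inner (J \<nu> h f) f \<le> 0"
proof -
  note f0 = has_L2_weak_deriv_0[OF f]
  have "L2_inner (J \<nu> h f) f = L2_inner (J1 \<nu> h f) f + L2_inner (J2 \<nu> h f) f"
    unfolding J_def[abs_def]
    by (intro L2_inner_add_left f has_L2_weak_deriv_L2[OF J1_L2_weak_deriv[OF f0]]
        has_L2_weak_deriv_L2[OF J2_L2_weak_deriv[OF assms(1,2) f0]])
  moreover have "h > 0"
    using assms(2) by (auto simp: mesh_sizes_def)
  ultimately show ?thesis
    using J1_dissipative[OF f, of h \<nu>] J2_dissipative[OF assms] by simp
qed

theorem lemma3p1:
  fixes \<nu> :: "real measure" and h :: real and l :: nat and \<phi> :: "real \<Rightarrow> real"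
  assumes "levy_measure \<nu>"
    and "h \<in> mesh_sizes"
    and "\<phi> \<in> sobolev l"
  shows "J \<nu> h \<phi> \<in> sobolev l \<and>
         (\<forall>j\<le>l. L2_inner (weak_deriv j (J \<nu> h \<phi>)) (weak_deriv j \<phi>) \<le> 0)"
proof (intro conjI allI impI)
  have ex: "\<exists>g. has_L2_weak_deriv j \<phi> g" if "j \<le> l" for j
    using assms(3) that by (auto simp: sobolev_def)
  show "J \<nu> h \<phi> \<in> sobolev l"
    unfolding sobolev_def
    using ex has_L2_weak_deriv_L2(1) J_L2_weak_deriv[OF assms(1,2)] by blast
  fix j assume "j \<le> l"
  then obtain g where g: "has_L2_weak_deriv j \<phi> g"
    using ex by blast
  show "L2_inner (weak_deriv j (J \<nu> h \<phi>)) (weak_deriv j \<phi>) \<le> 0"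
    \<comment> \<open>Since \<open>J \<nu> h g\<close> is a weak derivative of
      \<open>J \<nu> h \<phi>\<close>, the claim for order \<open>j\<close> becomes dissipativity at
      \<open>g\<close>, which is only known to lie in \<open>L2\<close>.\<close>
    unfolding L2_inner_weak_deriv[OF J_L2_weak_deriv[OF assms(1,2) g] g]
    by (rule J_dissipative[OF assms(1,2) has_L2_weak_deriv_L2(2)[OF g]])
qed

end
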